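(* Consider a time-homogeneous absorbing discrete-time Markov chain on the finite state space $\Omega=\{1,\dots,|\Omega|\}$ with transition matrix $P=\begin{bmatrix} Q & R\\ 0 & I\end{bmatrix}$ in canonical form (transient states first), and impulse-reward matrix $\Theta=\begin{bmatrix}\Theta_1 & \Theta_2\\ 0 & 0\end{bmatrix}$. Let $H=\Theta\odot P=\begin{bmatrix} H_1 & H_2\\ 0&0\end{bmatrix}$ and $N=(I-Q)^{-1}$. For every $n\ge1$ and every $i\in\Omega$, the expected accumulated reward at time $n$ given initial state $i$, $\bar R_n(i)=\mathbb E(R_n\mid S_0=i)$, satisfies $$\bar R_n(i)=\sum_{j=1}^{|\Omega|}\hat R_n(i,j),$$ where the matrix $\hat R_n=(\hat R_n(i,j))$ is given by $$\hat R_n=\begin{bmatrix}A_n & B_n\\ 0&0\end{bmatrix},\quad A_n=\sum_{k=0}^{n-1}Q^{k}H_1Q^{n-k-1},\quad B_n=N(I-Q^{n})H_2+N(I-Q^{n-1})H_1NR-\sum_{k=0}^{n-2}Q^{k}H_1NQ^{n-k-1}R.$$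
   Context: Let $S_0,S_1,\dots$ be a time-homogeneous Markov chain on a finite state space $\Omega=\{1,\dots,|\Omega|\}$ with transition probabilities $p_{ij}=\Pr(S_n=j\mid S_{n-1}=i)$ and transition matrix $P=(p_{ij})$. A state $i$ is absorbing if $p_{ii}=1$ (so $p_{ij}=0$ for $j\ne i$), and is transient otherwise. The chain is absorbing: there is at least one absorbing state, and from every transient state some absorbing state can be reached in finitely many transitions. Let $\Omega_T$ and $\Omega_A$ be the sets of transient and absorbing states; transient states have lower indices than absorbing states, so $P=\begin{bmatrix} Q & R\\ 0 & I\end{bmatrix}$ with $Q$ of size $|\Omega_T|\times|\Omega_T|$ and $R$ of size $|\Omega_T|\times|\Omega_A|$. The matrix $I-Q$ is invertible and $N=(I-Q)^{-1}$ is called the fundamental matrix. By convention $Q^0=I$ and empty sums are $0$. The impulse-reward matrix $\Theta=(\rho_{ij})$ is a real $|\Omega|\times|\Omega|$ matrix, $\rho_{ij}$ being the reward accumulated on a transition from $i$ to $j$. Transitions out of absorbing states carry zero reward, so $\Theta=\begin{bmatrix}\Theta_1 & \Theta_2\\ 0&0\end{bmatrix}$ with $\Theta_1$ of size $|\Omega_T|\times|\Omega_T|$ and $\Theta_2$ of size $|\Omega_T|\times|\Omega_A|$. $H=\Theta\odot P$ is the entrywise (Hadamard) product, $H(i,j)=\rho_{ij}p_{ij}$, with blocks $H_1,H_2$ partitioned in the same way. The accumulated reward at time $n\ge1$ is the random variable $R_n=\sum_{k=1}^{n}\rho_{S_{k-1}S_k}$ (not to be confused with the matrix $R$). Set $\bar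 R_n(i,j)=\mathbb E(R_n\mid S_0=i,S_n=j)$ and $\hat R_n(i,j)=\bar R_n(i,j)\cdot\Pr(S_n=j\mid S_0=i)$, with $\hat R_n(i,j)=0$ when $\Pr(S_n=j\mid S_0=i)=0$. *)

theory Defs
  imports "HOL-Probability.Probability" "Jordan_Normal_Form.Gauss_Jordan_Elimination"
begin

(* The state space {1,...,|Omega|} is {..<dim_row P}: states are numbered from 0, as are
   matrix rows and columns. *)

definition stochastic_matrix :: "real mat \<Rightarrow> bool" where
  "stochastic_matrix P \<longleftrightarrow> square_mat P
     \<and> (\<forall>i<dim_row P. \<forall>j<dim_col P. P $$ (i, j) \<ge> 0)
     \<and> (\<forall>i<dim_row P. (\<Sum>j<dim_col P. P $$ (i, j)) = 1)"

(* The initial distribution is arbitrary. Conditioning is restricted to events of positive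
   probability, because cond_prob is 0 for null conditions. *)
locale finite_markov_chain = prob_space M
  for M :: "'w measure" and S :: "nat \<Rightarrow> 'w \<Rightarrow> nat" and P :: "real mat" +
  assumes stochastic: "stochastic_matrix P"
    and random_state: "\<And>n. S n \<in> measurable M (count_space {..<dim_row P})"
    and markov: "\<And>n (s :: nat \<Rightarrow> nat) j.
      measure M {x \<in> space M. \<forall>k\<le>n. S k x = s k} > 0 \<Longrightarrow>
      cond_prob M (\<lambda>x. S (Suc n) x = j) (\<lambda>x. \<forall>k\<le>n. S k x = s k)
        = cond_prob M (\<lambda>x. S (Suc n) x = j) (\<lambda>x. S n x = s n)"
    and transition: "\<And>n i j. i < dim_row P \<Longrightarrow> j < dim_row P \<Longrightarrow>
      measure M {x \<in> space M. S n x = i} > 0 \<Longrightarrow>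
      cond_prob M (\<lambda>x. S (Suc n) x = j) (\<lambda>x. S n x = i) = P $$ (i, j)"

definition absorbing_state :: "real mat \<Rightarrow> nat \<Rightarrow> bool" where
  "absorbing_state P i \<longleftrightarrow> i < dim_row P \<and> P $$ (i, i) = 1"

definition transient_state :: "real mat \<Rightarrow> nat \<Rightarrow> bool" where
  "transient_state P i \<longleftrightarrow> i < dim_row P \<and> P $$ (i, i) \<noteq> 1"

definition transitions :: "real mat \<Rightarrow> (nat \<times> nat) set" where
  "transitions P = {(i, j). i < dim_row P \<and> j < dim_row P \<and> P $$ (i, j) > 0}"

definition absorbing_chain :: "real mat \<Rightarrow> bool" where
  "absorbing_chain P \<longleftrightarrow> (\<exists>j. absorbing_state P j)
     \<and> (\<forall>i. transient_state P i \<longrightarrow> (\<exists>j. absorbing_state P j \<and> (i, j) \<in> (transitions P)\<^sup>*))"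

definition hadamard :: "real mat \<Rightarrow> real mat \<Rightarrow> real mat" where
  "hadamard A B = mat (dim_row A) (dim_col A) (\<lambda>(i, j). A $$ (i, j) * B $$ (i, j))"

definition fundamental_matrix :: "real mat \<Rightarrow> real mat" where
  "fundamental_matrix Q = the (mat_inverse (1\<^sub>m (dim_row Q) - Q))"

(* The type of matrices has no zero matrix common to all dimensions, so the dimensions of a
   sum of matrices are given explicitly. *)
definition msum :: "nat \<Rightarrow> nat \<Rightarrow> (nat \<Rightarrow> real mat) \<Rightarrow> nat set \<Rightarrow> real mat" where
  "msum r c F K = mat r c (\<lambda>(i, j). \<Sum>k\<in>K. F k $$ (i, j))"

(* E(X | C), the analogue of cond_prob; meaningful when C has positive probability. *)
definition cond_expect :: "'w measure \<Rightarrow> ('w \<Rightarrow> real) \<Rightarrow> ('w \<Rightarrow> bool) \<Rightarrow> real" where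
  "cond_expect M X C =
     (LINT x:{x \<in> space M. C x}|M. X x) / measure M {x \<in> space M. C x}"

definition acc_reward :: "real mat \<Rightarrow> (nat \<Rightarrow> 'w \<Rightarrow> nat) \<Rightarrow> nat \<Rightarrow> 'w \<Rightarrow> real" where
  "acc_reward \<Theta> S n x = (\<Sum>k = 1..n. \<Theta> $$ (S (k - 1) x, S k x))"

definition mean_reward ::
    "'w measure \<Rightarrow> (nat \<Rightarrow> 'w \<Rightarrow> nat) \<Rightarrow> real mat \<Rightarrow> nat \<Rightarrow> nat \<Rightarrow> real" where
  "mean_reward M S \<Theta> n i = cond_expect M (acc_reward \<Theta> S n) (\<lambda>x. S 0 x = i)"

definition mean_reward_to ::
    "'w measure \<Rightarrow> (nat \<Rightarrow> 'w \<Rightarrow> nat) \<Rightarrow> real mat \<Rightarrow> nat \<Rightarrow> nat \<Rightarrow> nat \<Rightarrow> real" where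
  "mean_reward_to M S \<Theta> n i j =
     cond_expect M (acc_reward \<Theta> S n) (\<lambda>x. S 0 x = i \<and> S n x = j)"

definition weighted_reward ::
    "'w measure \<Rightarrow> (nat \<Rightarrow> 'w \<Rightarrow> nat) \<Rightarrow> real mat \<Rightarrow> nat \<Rightarrow> nat \<Rightarrow> nat \<Rightarrow> real" where
  "weighted_reward M S \<Theta> n i j =
     (if cond_prob M (\<lambda>x. S n x = j) (\<lambda>x. S 0 x = i) = 0 then 0
      else mean_reward_to M S \<Theta> n i j * cond_prob M (\<lambda>x. S n x = j) (\<lambda>x. S 0 x = i))"

end

(* Write V_n(i,j) = E(R_n; S_0 = i, S_n = j). Splitting off the last transition and using the Markov
   property for functionals of the past gives V_(n+1) = V_n P + W_n H with W_n = Pr(S_0 = i) P^n, so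
   that V_n / Pr(S_0 = i) = sum_(k<n) P^k H P^(n-k-1). Multiplying out the blocks, with
   sum_(l<m) Q^l = N (I - Q^m), yields A_n and B_n. The matrix I - Q is invertible by the maximum
   principle: a kernel vector, extended by 0, is harmonic, and the set where its modulus is maximal is
   closed under transitions, hence contains an absorbing state. *)

theory Submission
  imports Defs "Jordan_Normal_Form.Determinant"
begin

section \<open>Entrywise calculus of finite sums of matrices\<close>

lemma index_mult_mat_sum:
  assumes "A \<in> carrier_mat r c" "B \<in> carrier_mat c d" "i < r" "j < d"
  shows "(A * B) $$ (i, j) = (\<Sum>l<c. A $$ (i, l) * B $$ (l, j))"
  using assms by (auto simp: scalar_prod_def lessThan_atLeast0 intro!: sum.cong)

lemma msum_carrier [simp]: "msum r c F K \<in> carrier_mat r c"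
  by (simp add: msum_def)

lemma dim_msum [simp]: "dim_row (msum r c F K) = r" "dim_col (msum r c F K) = c"
  by (simp_all add: msum_def)

lemma index_msum [simp]:
  "i < r \<Longrightarrow> j < c \<Longrightarrow> msum r c F K $$ (i, j) = (\<Sum>k\<in>K. F k $$ (i, j))"
  by (simp add: msum_def)

lemma msum_empty [simp]: "msum r c F {} = 0\<^sub>m r c"
  by (rule eq_matI) auto

lemma msum_lessThan_Suc:
  "F n \<in> carrier_mat r c \<Longrightarrow> msum r c F {..<Suc n} = msum r c F {..<n} + F n"
  by (rule eq_matI) auto

lemma msum_add:
  assumes "\<And>k. k \<in> K \<Longrightarrow> F k \<in> carrier_mat r c" "\<And>k. k \<in> K \<Longrightarrow> G k \<in> carrier_mat r c"
  shows "msum r c (\<lambda>k. F k + G k) K = msum r c F K + msum r c G K"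
proof (rule eq_matI)
  fix i j assume "i < dim_row (msum r c F K + msum r c G K)" "j < dim_col (msum r c F K + msum r c G K)"
  then show "msum r c (\<lambda>k. F k + G k) K $$ (i, j) = (msum r c F K + msum r c G K) $$ (i, j)"
    using assms by (auto simp: sum.distrib[symmetric] intro!: sum.cong index_add_mat(1) dest: carrier_matD)
qed auto

lemma msum_minus:
  assumes "\<And>k. k \<in> K \<Longrightarrow> F k \<in> carrier_mat r c" "\<And>k. k \<in> K \<Longrightarrow> G k \<in> carrier_mat r c"
  shows "msum r c (\<lambda>k. F k - G k) K = msum r c F K - msum r c G K"
proof (rule eq_matI)
  fix i j assume "i < dim_row (msum r c F K - msum r c G K)" "j < dim_col (msum r c F K - msum r c G K)"
  then show "msum r c (\<lambda>k. F k - G k) K $$ (i, j) = (msum r c F K - msum r c G K) $$ (i, j)"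
    using assms by (auto simp: sum_subtractf[symmetric] intro!: sum.cong index_minus_mat(1) dest: carrier_matD)
qed auto

lemma msum_mult_right:
  assumes F: "\<And>k. k \<in> K \<Longrightarrow> F k \<in> carrier_mat r c" and C: "C \<in> carrier_mat c d"
  shows "msum r d (\<lambda>k. F k * C) K = msum r c F K * C"
proof (rule eq_matI)
  fix i j assume "i < dim_row (msum r c F K * C)" "j < dim_col (msum r c F K * C)"
  with C have ij: "i < r" "j < d" by auto
  have "msum r d (\<lambda>k. F k * C) K $$ (i, j) = (\<Sum>k\<in>K. \<Sum>l<c. F k $$ (i, l) * C $$ (l, j))"
    using ij by (auto simp: index_mult_mat_sum[OF F C])
  also have "\<dots> = (\<Sum>l<c. (\<Sum>k\<in>K. F k $$ (i, l)) * C $$ (l, j))"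
    by (subst sum.swap) (simp add: sum_distrib_right)
  also have "\<dots> = (msum r c F K * C) $$ (i, j)"
    using ij by (simp add: index_mult_mat_sum[OF msum_carrier C])
  finally show "msum r d (\<lambda>k. F k * C) K $$ (i, j) = (msum r c F K * C) $$ (i, j)" .
qed (use C in auto)

text \<open>Lets the sum over the position of the rewarded step be computed one block at a
  time.\<close>

lemma msum_four_block:
  assumes "\<And>k. k \<in> K \<Longrightarrow> A k \<in> carrier_mat r1 c1" "\<And>k. k \<in> K \<Longrightarrow> B k \<in> carrier_mat r1 c2"
    "\<And>k. k \<in> K \<Longrightarrow> C k \<in> carrier_mat r2 c1" "\<And>k. k \<in> K \<Longrightarrow> D k \<in> carrier_mat r2 c2"
  shows "msum (r1 + r2) (c1 + c2) (\<lambda>k. four_block_mat (A k) (B k) (C k) (D k)) K =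
    four_block_mat (msum r1 c1 A K) (msum r1 c2 B K) (msum r2 c1 C K) (msum r2 c2 D K)"
    (is "?L = ?R")
proof (rule eq_matI)
  fix i j assume ij: "i < dim_row ?R" "j < dim_col ?R"
  have dims: "dim_row (A k) = r1 \<and> dim_col (A k) = c1 \<and> dim_row (D k) = r2 \<and> dim_col (D k) = c2"
    if "k \<in> K" for k
    using assms(1,4)[OF that] by auto
  have "?L $$ (i, j) = (\<Sum>k\<in>K. if i < r1 then if j < c1 then A k $$ (i, j) else B k $$ (i, j - c1)
      else if j < c1 then C k $$ (i - r1, j) else D k $$ (i - r1, j - c1))"
    using ij dims by (auto intro!: sum.cong)
  also have "\<dots> = ?R $$ (i, j)" using ij by auto
  finally show "?L $$ (i, j) = ?R $$ (i, j)" .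
qed auto

lemma msum_zero [simp]: "msum r c (\<lambda>k. 0\<^sub>m r c) K = 0\<^sub>m r c"
  by (rule eq_matI) auto

section \<open>Geometric sums and the transient-to-absorbing reward block\<close>

text \<open>\<open>pow_mat\<close> recurses by a factor on the right, whereas the telescoping of the
  geometric sum produces the factor on the left.\<close>

lemma pow_mat_commute:
  "Q \<in> carrier_mat t t \<Longrightarrow> Q ^\<^sub>m n * Q = Q * Q ^\<^sub>m n"
proof (induction n)
  case (Suc n)
  then have "Q ^\<^sub>m Suc n * Q = Q * Q ^\<^sub>m n * Q" by simp
  also have "\<dots> = Q * Q ^\<^sub>m Suc n" using Suc.prems by (simp add: assoc_mult_mat[of _ t t _ t _ t])
  finally show ?case .
qed simp

context
  fixes Q N :: "real mat" and t :: nat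
  assumes Q: "Q \<in> carrier_mat t t" and N: "N \<in> carrier_mat t t" and NQ: "N * (1\<^sub>m t - Q) = 1\<^sub>m t"
begin

text \<open>Telescoping: since N (I - Q) = I, the new term Q^n equals N (I - Q) Q^n, and (I - Q^n) +
  (I - Q) Q^n = I - Q^(n+1).\<close>

lemma geometric_msum: "msum t t (\<lambda>k. Q ^\<^sub>m k) {..<n} = N * (1\<^sub>m t - Q ^\<^sub>m n)"
proof (induction n)
  case 0
  then show ?case using Q N by (simp add: minus_r_inv_mat[of _ t t])
next
  case (Suc n)
  have pow: "Q ^\<^sub>m n \<in> carrier_mat t t" using Q by simp
  have IQ: "1\<^sub>m t - Q \<in> carrier_mat t t" and IQn: "1\<^sub>m t - Q ^\<^sub>m n \<in> carrier_mat t t"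
    using Q pow by (simp_all add: minus_carrier_mat)
  have comm: "Q ^\<^sub>m n * Q = Q * Q ^\<^sub>m n"
    using Q by (rule pow_mat_commute)
  have "N * (1\<^sub>m t - Q ^\<^sub>m n) + Q ^\<^sub>m n = N * (1\<^sub>m t - Q ^\<^sub>m n) + N * (1\<^sub>m t - Q) * Q ^\<^sub>m n"
    using NQ pow left_mult_one_mat[OF pow] by simp
  also have "\<dots> = N * ((1\<^sub>m t - Q ^\<^sub>m n) + (1\<^sub>m t - Q) * Q ^\<^sub>m n)"
    using mult_carrier_mat[OF IQ pow]
    by (simp only: mult_add_distrib_mat[OF N IQn] assoc_mult_mat[OF N IQ pow])
  also have "(1\<^sub>m t - Q ^\<^sub>m n) + (1\<^sub>m t - Q) * Q ^\<^sub>m n = 1\<^sub>m t - Q ^\<^sub>m Suc n"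
    using Q pow comm by (subst minus_mult_distrib_mat[of _ t t _ _ t]) (auto intro!: eq_matI)
  finally show ?case using pow Suc by (simp add: msum_lessThan_Suc)
qed

text \<open>The left side is the upper right block of the sum over k of P^k H P^(n-k-1). Writing the
  inner geometric sum as N (I - Q^(n-k-1)) splits each H1 term into \<open>?Y k\<close> and a part
  whose sum over k is again geometric.\<close>

lemma msum_reward_block:
  assumes R: "R \<in> carrier_mat t a" and H1: "H1 \<in> carrier_mat t t" and H2: "H2 \<in> carrier_mat t a"
    and n: "n \<ge> 1"
  shows "msum t a (\<lambda>k. Q ^\<^sub>m k * H1 * (msum t t (\<lambda>k. Q ^\<^sub>m k) {..<n - k - 1} * R) + Q ^\<^sub>m k * H2) {..<n} =
    N * (1\<^sub>m t - Q ^\<^sub>m n) * H2 + N * (1\<^sub>m t - Q ^\<^sub>m (n - 1)) * H1 * N * R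
      - msum t a (\<lambda>k. (Q ^\<^sub>m k) * H1 * N * (Q ^\<^sub>m (n - k - 1)) * R) {..<n - 1}"
proof -
  obtain m where m: "n = Suc m" using n by (cases n) auto
  let ?S = "\<lambda>l. msum t t (\<lambda>k. Q ^\<^sub>m k) {..<l}"
  let ?F = "\<lambda>k. Q ^\<^sub>m k * H1 * (?S (n - k - 1) * R)"
  let ?Y = "\<lambda>k. Q ^\<^sub>m k * H1 * N * (Q ^\<^sub>m (n - k - 1)) * R"
  note pow = pow_carrier_mat[OF Q]
  note mult = mult_carrier_mat
  have QH: "Q ^\<^sub>m k * H1 \<in> carrier_mat t t" for k by (rule mult[OF pow H1])
  have F: "?F k \<in> carrier_mat t a" for k by (rule mult[OF QH mult[OF msum_carrier R]])
  have HNR: "H1 * N * R \<in> carrier_mat t a" by (rule mult[OF mult[OF H1 N] R])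
  have X: "Q ^\<^sub>m k * (H1 * N * R) \<in> carrier_mat t a" for k by (rule mult[OF pow HNR])
  have Y: "?Y k \<in> carrier_mat t a" for k by (rule mult[OF mult[OF mult[OF QH N] pow] R])
  have Z: "N * (1\<^sub>m t - Q ^\<^sub>m n) * H2 \<in> carrier_mat t a"
    by (intro mult[OF mult[OF N] H2] minus_carrier_mat pow)
  have split: "?F k = Q ^\<^sub>m k * (H1 * N * R) - ?Y k" for k
  proof -
    let ?q = "Q ^\<^sub>m (n - k - 1)"
    have IQ: "1\<^sub>m t - ?q \<in> carrier_mat t t" by (rule minus_carrier_mat[OF pow])
    have "?F k = Q ^\<^sub>m k * H1 * (N * (1\<^sub>m t - ?q) * R)" by (simp only: geometric_msum)
    also have "\<dots> = Q ^\<^sub>m k * H1 * N * (1\<^sub>m t - ?q) * R"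
      by (simp only: assoc_mult_mat[OF N IQ R] assoc_mult_mat[OF QH N mult[OF IQ R], symmetric]
          assoc_mult_mat[OF mult[OF QH N] IQ R])
    also have "Q ^\<^sub>m k * H1 * N * (1\<^sub>m t - ?q) = Q ^\<^sub>m k * H1 * N - Q ^\<^sub>m k * H1 * N * ?q"
      by (simp only: mult_minus_distrib_mat[OF mult[OF QH N] one_carrier_mat pow]
          right_mult_one_mat[OF mult[OF QH N]])
    also have "\<dots> * R = Q ^\<^sub>m k * H1 * N * R - ?Y k"
      by (rule minus_mult_distrib_mat[OF mult[OF QH N] mult[OF mult[OF QH N] pow] R])
    also have "Q ^\<^sub>m k * H1 * N * R = Q ^\<^sub>m k * (H1 * N * R)"
      by (simp only: assoc_mult_mat[OF pow H1 N] assoc_mult_mat[OF pow mult[OF H1 N] R])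
    finally show ?thesis .
  qed
  \<comment> \<open>For the last index k = n - 1 the inner geometric sum is empty, so the term
    vanishes. This is why the H1 contributions to B_n stop at n - 2 while the H2 contribution keeps
    all n terms.\<close>
  have "?F m = 0\<^sub>m t a"
    using right_mult_zero_mat[OF QH[of m], of a] R by (simp add: m left_mult_zero_mat[OF R])
  then have "msum t a ?F {..<n} = msum t a ?F {..<n - 1}"
    using msum_lessThan_Suc[of ?F m t a, OF F] by (simp only: m diff_Suc_1 right_add_zero_mat[OF msum_carrier])
  also have "\<dots> = msum t a (\<lambda>k. Q ^\<^sub>m k * (H1 * N * R)) {..<n - 1} - msum t a ?Y {..<n - 1}"
    unfolding split by (rule msum_minus[OF X Y])
  also have "msum t a (\<lambda>k. Q ^\<^sub>m k * (H1 * N * R)) {..<n - 1} = ?S (n - 1) * (H1 * N * R)"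
    by (rule msum_mult_right[OF pow HNR])
  also have "\<dots> = ?S (n - 1) * H1 * N * R"
    by (simp only: assoc_mult_mat[OF msum_carrier H1 N] assoc_mult_mat[OF msum_carrier mult[OF H1 N] R])
  also have "\<dots> = N * (1\<^sub>m t - Q ^\<^sub>m (n - 1)) * H1 * N * R" by (simp only: geometric_msum)
  finally have first: "msum t a ?F {..<n} = N * (1\<^sub>m t - Q ^\<^sub>m (n - 1)) * H1 * N * R - msum t a ?Y {..<n - 1}" .
  have second: "msum t a (\<lambda>k. Q ^\<^sub>m k * H2) {..<n} = N * (1\<^sub>m t - Q ^\<^sub>m n) * H2"
    unfolding geometric_msum[symmetric] by (rule msum_mult_right[OF pow H2])
  have carrier: "N * (1\<^sub>m t - Q ^\<^sub>m (n - 1)) * H1 * N * R \<in> carrier_mat t a"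
    by (intro mult[OF mult[OF mult[OF mult[OF N] H1] N] R] minus_carrier_mat pow)
  have arrange: "X - Y + Z = Z + X - Y"
    if "X \<in> carrier_mat t a" "Y \<in> carrier_mat t a" "Z \<in> carrier_mat t a" for X Y Z :: "real mat"
    using that by (intro eq_matI) auto
  have "msum t a (\<lambda>k. ?F k + Q ^\<^sub>m k * H2) {..<n} =
      msum t a ?F {..<n} + msum t a (\<lambda>k. Q ^\<^sub>m k * H2) {..<n}"
    by (rule msum_add[OF F mult[OF pow H2]])
  then show ?thesis
    unfolding first second arrange[OF carrier msum_carrier Z] .
qed

end

section \<open>Powers of P and reward terms in block form\<close>

text \<open>Absorption in a given state within n steps means k < n transient moves followed by one
  move given by R, whence the geometric sum. In the induction the new factor P adds Q^n R to this
  block, and its identity block keeps what is already absorbed.\<close>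

lemma pow_four_block_absorbing:
  assumes Q: "Q \<in> carrier_mat t t" and R: "R \<in> carrier_mat t a"
  shows "four_block_mat Q R (0\<^sub>m a t) (1\<^sub>m a) ^\<^sub>m n =
    four_block_mat (Q ^\<^sub>m n) (msum t t (\<lambda>k. Q ^\<^sub>m k) {..<n} * R) (0\<^sub>m a t) (1\<^sub>m a)"
proof (induction n)
  case 0
  then show ?case using Q R by simp
next
  case (Suc n)
  have pow: "Q ^\<^sub>m n \<in> carrier_mat t t" using Q by simp
  have S: "msum t t (\<lambda>k. Q ^\<^sub>m k) {..<n} * R \<in> carrier_mat t a"
    using R by (auto intro!: mult_carrier_mat[of _ t t])
  have "Q ^\<^sub>m n * R + msum t t (\<lambda>k. Q ^\<^sub>m k) {..<n} * R = msum t t (\<lambda>k. Q ^\<^sub>m k) {..<Suc n} * R"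
    using pow R by (simp add: mult_carrier_mat[of _ t t] msum_lessThan_Suc add_mult_distrib_mat[of _ t t] comm_add_mat[of "Q ^\<^sub>m n * R" t a])
  then show ?case
    using Q R S pow mult_carrier_mat[OF pow Q] by (simp add: Suc mult_four_block_mat[of _ t t _ a _ a _ _ t _ a])
qed

text \<open>This is the contribution of step k + 1 when l steps follow. A move weighted by H1 leaves
  the path transient, so absorption may still occur during the l later steps; a move weighted by H2
  has absorbed it, so no later power enters that term. The zero rows of H remove the upper right
  block of P^k.\<close>

lemma block_step_rewards:
  assumes Q: "Q \<in> carrier_mat t t" and R: "R \<in> carrier_mat t a"
    and H1: "H1 \<in> carrier_mat t t" and H2: "H2 \<in> carrier_mat t a"
  defines "P \<equiv> four_block_mat Q R (0\<^sub>m a t) (1\<^sub>m a)"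
  shows "P ^\<^sub>m k * four_block_mat H1 H2 (0\<^sub>m a t) (0\<^sub>m a a) * P ^\<^sub>m l =
    four_block_mat (Q ^\<^sub>m k * H1 * Q ^\<^sub>m l)
      (Q ^\<^sub>m k * H1 * (msum t t (\<lambda>k. Q ^\<^sub>m k) {..<l} * R) + Q ^\<^sub>m k * H2) (0\<^sub>m a t) (0\<^sub>m a a)"
proof -
  have pow: "Q ^\<^sub>m n \<in> carrier_mat t t" for n using Q by simp
  have S: "msum t t (\<lambda>k. Q ^\<^sub>m k) {..<n} * R \<in> carrier_mat t a" for n
    using R by (auto intro!: mult_carrier_mat[of _ t t])
  have QH: "Q ^\<^sub>m k * H1 \<in> carrier_mat t t" "Q ^\<^sub>m k * H2 \<in> carrier_mat t a"
    using H1 H2 pow by (auto intro!: mult_carrier_mat[of _ t t])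
  have QHQ: "Q ^\<^sub>m k * H1 * Q ^\<^sub>m l \<in> carrier_mat t t"
    "Q ^\<^sub>m k * H1 * (msum t t (\<lambda>k. Q ^\<^sub>m k) {..<l} * R) \<in> carrier_mat t a"
    using QH pow S by (auto intro!: mult_carrier_mat[of _ t t])
  have "P ^\<^sub>m k * four_block_mat H1 H2 (0\<^sub>m a t) (0\<^sub>m a a) =
     four_block_mat (Q ^\<^sub>m k * H1) (Q ^\<^sub>m k * H2) (0\<^sub>m a t) (0\<^sub>m a a)"
    unfolding P_def pow_four_block_absorbing[OF Q R]
    using H1 H2 pow[of k] S[of k]
    by (subst mult_four_block_mat[of _ t t _ a _ a _ _ t _ a]) auto
  moreover have "\<dots> * P ^\<^sub>m l = four_block_mat (Q ^\<^sub>m k * H1 * Q ^\<^sub>m l)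
      (Q ^\<^sub>m k * H1 * (msum t t (\<lambda>k. Q ^\<^sub>m k) {..<l} * R) + Q ^\<^sub>m k * H2) (0\<^sub>m a t) (0\<^sub>m a a)"
    unfolding P_def pow_four_block_absorbing[OF Q R]
      mult_four_block_mat[OF QH zero_carrier_mat zero_carrier_mat pow S zero_carrier_mat one_carrier_mat]
    using right_mult_zero_mat[OF QH(2), of t] right_add_zero_mat[OF QHQ(1)]
      right_mult_one_mat[OF QH(2)] left_mult_zero_mat[OF pow[of l], of a] left_mult_zero_mat[OF S[of l], of a]
    by simp
  ultimately show ?thesis by simp
qed

section \<open>Maximum principle and invertibility of I - Q\<close>

text \<open>The value f i is a convex combination of values of modulus at most c, so modulus c at i
  forces modulus c at every successor of positive probability. Following a path to an absorbing
  state, where f is 0, gives c = 0.\<close>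

lemma harmonic_zero:
  fixes f :: "nat \<Rightarrow> real"
  assumes stoch: "stochastic_matrix P" and abs: "absorbing_chain P"
    and harmonic: "\<And>i. i < dim_row P \<Longrightarrow> f i = (\<Sum>j<dim_row P. P $$ (i, j) * f j)"
    and zero: "\<And>j. absorbing_state P j \<Longrightarrow> f j = 0"
    and i: "i < dim_row P"
  shows "f i = 0"
proof -
  define c where "c = Max ((\<lambda>i. \<bar>f i\<bar>) ` {..<dim_row P})"
  have le: "\<bar>f i\<bar> \<le> c" if "i < dim_row P" for i
    unfolding c_def using that by (intro Max_ge) auto
  have "c \<in> (\<lambda>i. \<bar>f i\<bar>) ` {..<dim_row P}"
    unfolding c_def using i by (intro Max_in) auto
  then obtain i0 where i0: "i0 < dim_row P" "\<bar>f i0\<bar> = c" by auto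
  have step: "\<bar>f j\<bar> = c" if "(i, j) \<in> transitions P" "\<bar>f i\<bar> = c" for i j
  proof -
    have ij: "i < dim_row P" "j < dim_row P" "P $$ (i, j) > 0"
      using that by (auto simp: transitions_def)
    have nonneg: "P $$ (i, l) \<ge> 0" if "l < dim_row P" for l
      using stoch ij that by (auto simp: stochastic_matrix_def)
    have rowsum: "(\<Sum>l<dim_row P. P $$ (i, l)) = 1"
      using stoch ij by (auto simp: stochastic_matrix_def)
    have "c \<le> (\<Sum>l<dim_row P. \<bar>P $$ (i, l) * f l\<bar>)"
      using that(2) harmonic[OF ij(1)] sum_abs[of "\<lambda>l. P $$ (i, l) * f l" "{..<dim_row P}"] by simp
    also have "\<dots> = (\<Sum>l<dim_row P. P $$ (i, l) * \<bar>f l\<bar>)"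
      using nonneg by (simp add: abs_mult)
    \<comment> \<open>As the row sums to 1, the bound on c becomes a sum of nonnegative terms that
      is at most 0, so every term vanishes.\<close>
    finally have "(\<Sum>l<dim_row P. P $$ (i, l) * (c - \<bar>f l\<bar>)) \<le> 0"
      using rowsum by (simp add: right_diff_distrib sum_subtractf flip: sum_distrib_right)
    moreover have "P $$ (i, l) * (c - \<bar>f l\<bar>) \<ge> 0" if "l < dim_row P" for l
      using nonneg[OF that] le[OF that] by simp
    ultimately have "P $$ (i, j) * (c - \<bar>f j\<bar>) = 0"
      using ij sum_nonneg_0[of "{..<dim_row P}" "\<lambda>l. P $$ (i, l) * (c - \<bar>f l\<bar>)" j]
      by (smt (verit) finite_lessThan lessThan_iff sum_nonneg)
    with ij show ?thesis by simp
  qed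
  \<comment> \<open>If \<open>i0\<close> is itself absorbing, the trivial path serves.\<close>
  obtain j where j: "absorbing_state P j" "(i0, j) \<in> (transitions P)\<^sup>*"
    using abs i0(1) unfolding absorbing_chain_def absorbing_state_def transient_state_def by blast
  from j(2) have "\<bar>f j\<bar> = c" by (induction rule: rtrancl_induct) (use i0 step in auto)
  with zero[OF j(1)] le[OF i] show ?thesis by simp
qed

text \<open>\<open>fundamental_matrix\<close> applies \<open>the\<close> to the result of
  \<open>mat_inverse\<close>, so it is meaningful only once I - Q is known to be invertible. A
  singular I - Q would have a nonzero kernel vector, which the maximum principle excludes.\<close>

lemma fundamental_matrix_inverse:
  assumes stoch: "stochastic_matrix P" and abs: "absorbing_chain P"
    and Q: "Q \<in> carrier_mat t t" and R: "R \<in> carrier_mat t a"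
    and P: "P = four_block_mat Q R (0\<^sub>m a t) (1\<^sub>m a)"
    and transient_first: "\<And>i. i < t \<Longrightarrow> transient_state P i"
  shows "fundamental_matrix Q \<in> carrier_mat t t"
    and "fundamental_matrix Q * (1\<^sub>m t - Q) = 1\<^sub>m t"
proof -
  have IQ: "1\<^sub>m t - Q \<in> carrier_mat t t" using Q by (simp add: minus_carrier_mat)
  have "Determinant.det (1\<^sub>m t - Q) \<noteq> 0"
  proof
    assume "Determinant.det (1\<^sub>m t - Q) = 0"
    then obtain v where v: "v \<in> carrier_vec t" "v \<noteq> 0\<^sub>v t" "(1\<^sub>m t - Q) *\<^sub>v v = 0\<^sub>v t"
      using det_0_iff_vec_prod_zero_field[OF IQ] by auto
    \<comment> \<open>Extension by 0 turns v = Q v into a harmonic function of P: in a transient row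
      the R part meets only zeros, and in an absorbing row both sides are 0.\<close>
    define f where "f i = (if i < t then vec_index v i else 0)" for i
    have dim: "dim_row P = t + a" using P Q by simp
    have vi: "vec_index v i = (\<Sum>j<t. Q $$ (i, j) * vec_index v j)" if "i < t" for i
    proof -
      have "(\<Sum>j<t. (of_bool (i = j) - Q $$ (i, j)) * vec_index v j) = vec_index ((1\<^sub>m t - Q) *\<^sub>v v) i"
        using that Q v(1) by (auto simp: scalar_prod_def lessThan_atLeast0 intro!: sum.cong)
      then have "(\<Sum>j<t. of_bool (i = j) * vec_index v j) - (\<Sum>j<t. Q $$ (i, j) * vec_index v j) = 0"
        using v(3) that by (simp add: left_diff_distrib sum_subtractf)
      moreover have "(\<Sum>j<t. of_bool (i = j) * vec_index v j) = vec_index v i"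
        using that by (subst sum.remove[of _ i]) auto
      ultimately show ?thesis by simp
    qed
    have "f i = 0" if "i < t" for i
    proof (rule harmonic_zero[OF stoch abs])
      show "i < dim_row P" using that dim by simp
      show "f j = 0" if "absorbing_state P j" for j
        using that transient_first[of j] by (auto simp: absorbing_state_def transient_state_def f_def)
      fix i assume i: "i < dim_row P"
      have "(\<Sum>j<dim_row P. P $$ (i, j) * f j) = (\<Sum>j<t. P $$ (i, j) * f j)"
        unfolding dim by (rule sum.mono_neutral_right) (auto simp: f_def)
      also have "\<dots> = f i"
      proof (cases "i < t")
        case True
        then have "f i = (\<Sum>j<t. Q $$ (i, j) * vec_index v j)"
          using True vi[OF True] by (simp only: f_def if_True)
        with True Q show ?thesis by (simp add: f_def P)
      next
        case False
        with i Q dim show ?thesis by (auto simp: f_def P intro!: sum.neutral)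
      qed
      finally show "f i = (\<Sum>j<dim_row P. P $$ (i, j) * f j)" by simp
    qed
    then have "v = 0\<^sub>v t" using v(1) by (intro eq_vecI) (auto simp: f_def)
    with v(2) show False by simp
  qed
  \<comment> \<open>Being a unit rules out the result \<open>None\<close> of
    \<open>mat_inverse\<close>.\<close>
  then have "1\<^sub>m t - Q \<in> Units (ring_mat TYPE(real) t ())"
    by (rule det_non_zero_imp_unit[OF IQ])
  then obtain B where "mat_inverse (1\<^sub>m t - Q) = Some B"
    using mat_inverse(1)[OF IQ, where b = "()"] by (cases "mat_inverse (1\<^sub>m t - Q)") auto
  then show "fundamental_matrix Q \<in> carrier_mat t t" "fundamental_matrix Q * (1\<^sub>m t - Q) = 1\<^sub>m t"
    using mat_inverse(2)[OF IQ] Q by (auto simp: fundamental_matrix_def)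
qed

section \<open>Functionals of the history up to time n\<close>

text \<open>The discrete counterpart of measurability with respect to S_0, ..., S_n, stated for
  functions of a whole state sequence so that they can be evaluated along
  \<open>\<lambda>k. S k x\<close>.\<close>

definition history_dependent :: "nat \<Rightarrow> ((nat \<Rightarrow> nat) \<Rightarrow> real) \<Rightarrow> bool" where
  "history_dependent n g \<longleftrightarrow> (\<forall>s s'. (\<forall>k\<le>n. s k = s' k) \<longrightarrow> g s = g s')"

lemma history_dependentD:
  "history_dependent n g \<Longrightarrow> (\<And>k. k \<le> n \<Longrightarrow> s k = s' k) \<Longrightarrow> g s = g s'"
  by (auto simp: history_dependent_def)

lemma history_dependent_mult:
  "history_dependent n f \<Longrightarrow> history_dependent n g \<Longrightarrow> history_dependent n (\<lambda>s. f s * g s)"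
  unfolding history_dependent_def by metis

lemma history_dependent_coordinate:
  "k \<le> n \<Longrightarrow> history_dependent n (\<lambda>s. h (s k))"
  by (simp add: history_dependent_def)

lemma history_dependent_mono:
  "history_dependent m g \<Longrightarrow> m \<le> n \<Longrightarrow> history_dependent n g"
  unfolding history_dependent_def by (meson le_trans)

text \<open>Taking the coordinate maps as the process makes the accumulated reward itself a function
  of the path; \<open>acc_reward_path\<close> translates back to \<open>S\<close>.\<close>

lemma history_dependent_acc_reward:
  "history_dependent n (acc_reward \<Theta> (\<lambda>k s. s k) n)"
  by (auto simp: history_dependent_def acc_reward_def intro!: sum.cong)

lemma acc_reward_path: "acc_reward \<Theta> (\<lambda>k s. s k) n (\<lambda>k. S k x) = acc_reward \<Theta> S n x"
  by (simp add: acc_reward_def)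

lemma acc_reward_Suc:
  "acc_reward \<Theta> S (Suc n) x = acc_reward \<Theta> S n x + \<Theta> $$ (S n x, S (Suc n) x)"
  by (simp add: acc_reward_def)

section \<open>The Markov property for functionals of the past\<close>

context finite_markov_chain
begin

lemma state_less: "x \<in> space M \<Longrightarrow> S n x < dim_row P"
  using measurable_space[OF random_state[of n]] by auto

lemma state_event [measurable]: "{x \<in> space M. S n x = j} \<in> events"
proof (cases "j < dim_row P")
  case True
  then have "S n -` {j} \<inter> space M \<in> events" by (intro measurable_sets[OF random_state]) auto
  also have "S n -` {j} \<inter> space M = {x \<in> space M. S n x = j}" by auto
  finally show ?thesis .
next
  case False
  then have "{x \<in> space M. S n x = j} = {}" using state_less by fastforce
  then show ?thesis by (simp only: sets.empty_sets)
qed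

lemma history_event [measurable]: "{x \<in> space M. \<forall>k\<le>n. S k x = s k} \<in> events"
proof -
  have "{x \<in> space M. \<forall>k\<le>n. S k x = s k} = (\<Inter>k\<in>{..n}. {x \<in> space M. S k x = s k})" by auto
  also have "\<dots> \<in> events" by (intro sets.finite_INT) auto
  finally show ?thesis .
qed

text \<open>Multiplying the Markov and transition assumptions by the probability of the condition
  removes the quotient, so that null histories are covered as well, with both sides 0.\<close>

lemma history_step:
  assumes s: "s n < dim_row P" and j: "j < dim_row P"
  shows "prob {x \<in> space M. (\<forall>k\<le>n. S k x = s k) \<and> S (Suc n) x = j} =
    prob {x \<in> space M. \<forall>k\<le>n. S k x = s k} * P $$ (s n, j)"
proof (cases "prob {x \<in> space M. \<forall>k\<le>n. S k x = s k} = 0")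
  case True
  have "prob {x \<in> space M. (\<forall>k\<le>n. S k x = s k) \<and> S (Suc n) x = j} \<le>
      prob {x \<in> space M. \<forall>k\<le>n. S k x = s k}"
    by (rule finite_measure_mono) auto
  with True show ?thesis by (simp add: measure_le_0_iff)
next
  case False
  then have pos: "prob {x \<in> space M. \<forall>k\<le>n. S k x = s k} > 0"
    by (simp add: zero_less_measure_iff)
  have "prob {x \<in> space M. \<forall>k\<le>n. S k x = s k} \<le> prob {x \<in> space M. S n x = s n}"
    by (rule finite_measure_mono) auto
  with pos have pos': "prob {x \<in> space M. S n x = s n} > 0" by simp
  have "cond_prob M (\<lambda>x. S (Suc n) x = j) (\<lambda>x. \<forall>k\<le>n. S k x = s k) = P $$ (s n, j)"
    using markov[OF pos] transition[OF s j pos'] by simp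
  then show ?thesis using False by (simp add: cond_prob_def field_simps conj_commute)
qed

text \<open>Extensional functions represent each history up to time n exactly once, so the set is
  finite and the events indexed by it are disjoint.\<close>

abbreviation (input) histories :: "nat \<Rightarrow> (nat \<Rightarrow> nat) set" where
  "histories n \<equiv> {..n} \<rightarrow>\<^sub>E {..<dim_row P}"

text \<open>At each sample point exactly one history is realised. A functional of the past is thus a
  finite combination of indicators, and its expectation reduces to probabilities of
  histories.\<close>

lemma history_expand:
  assumes g: "history_dependent n g" and x: "x \<in> space M"
  shows "g (\<lambda>k. S k x) =
    (\<Sum>s\<in>histories n. g s * indicator {x \<in> space M. \<forall>k\<le>n. S k x = s k} x)"
proof -
  define s0 where "s0 = restrict (\<lambda>k. S k x) {..n}"
  have s0: "s0 \<in> histories n" using state_less[OF x] by (auto simp: s0_def)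
  have uniq: "s = s0" if "s \<in> histories n" "\<forall>k\<le>n. S k x = s k" for s
    using that by (auto simp: s0_def PiE_def extensional_def restrict_def)
  have "(\<Sum>s\<in>histories n. g s * indicator {x \<in> space M. \<forall>k\<le>n. S k x = s k} x) =
      g s0 * indicator {x \<in> space M. \<forall>k\<le>n. S k x = s0 k} x"
    using s0 uniq by (subst sum.remove[OF _ s0])
      (auto intro!: finite_PiE sum.neutral simp: indicator_def)
  also have "\<dots> = g s0" using x by (simp add: s0_def)
  also have "g s0 = g (\<lambda>k. S k x)" by (rule history_dependentD[OF g]) (simp add: s0_def)
  finally show ?thesis by simp
qed

lemma integrable_history:
  assumes "history_dependent n g"
  shows "integrable M (\<lambda>x. g (\<lambda>k. S k x))"
  by (subst Bochner_Integration.integrable_cong[OF refl history_expand[OF assms]])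
    (auto simp: emeasure_eq_measure)

text \<open>Expansion over histories reduces the claim to \<open>history_step\<close>. The factor
  \<open>P $$ (s n, j)\<close> is again a function of the history, so the sum collapses back into
  one expectation.\<close>

lemma expectation_step:
  assumes g: "history_dependent n g" and j: "j < dim_row P"
  shows "expectation (\<lambda>x. g (\<lambda>k. S k x) * of_bool (S (Suc n) x = j)) =
    expectation (\<lambda>x. g (\<lambda>k. S k x) * P $$ (S n x, j))"
proof -
  let ?E = "\<lambda>s. {x \<in> space M. \<forall>k\<le>n. S k x = s k}"
  let ?F = "\<lambda>s. {x \<in> space M. (\<forall>k\<le>n. S k x = s k) \<and> S (Suc n) x = j}"
  have F: "?F s \<in> events" for s
  proof -
    have "?F s = ?E s \<inter> {x \<in> space M. S (Suc n) x = j}" by auto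
    then show ?thesis by (simp only: sets.Int[OF history_event state_event])
  qed
  have "expectation (\<lambda>x. g (\<lambda>k. S k x) * of_bool (S (Suc n) x = j)) =
      expectation (\<lambda>x. \<Sum>s\<in>histories n. g s * indicator (?F s) x)"
    by (intro Bochner_Integration.integral_cong refl, subst history_expand[OF g])
      (auto simp: sum_distrib_right indicator_def intro!: sum.cong)
  also have "\<dots> = (\<Sum>s\<in>histories n. g s * prob (?F s))"
    using F by (subst Bochner_Integration.integral_sum) (auto simp: emeasure_eq_measure)
  also have "\<dots> = (\<Sum>s\<in>histories n. g s * P $$ (s n, j) * prob (?E s))"
    using j by (intro sum.cong refl) (subst history_step; auto simp: PiE_def)
  also have "\<dots> = expectation (\<lambda>x. \<Sum>s\<in>histories n. (g s * P $$ (s n, j)) * indicator (?E s) x)"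
    by (subst Bochner_Integration.integral_sum) (auto simp: emeasure_eq_measure)
  also have "\<dots> = expectation (\<lambda>x. g (\<lambda>k. S k x) * P $$ (S n x, j))"
    by (intro Bochner_Integration.integral_cong refl
        history_expand[where g = "\<lambda>s. g s * P $$ (s n, j)", symmetric]
        history_dependent_mult g history_dependent_coordinate[where h = "\<lambda>u. P $$ (u, j)"]) auto
  finally show ?thesis .
qed

text \<open>Partitioning by the value u of S_n turns the expectation into a row vector applied to
  h.\<close>

lemma expectation_split_state:
  assumes g: "history_dependent n g"
  shows "expectation (\<lambda>x. g (\<lambda>k. S k x) * h (S n x)) =
    (\<Sum>u<dim_row P. expectation (\<lambda>x. g (\<lambda>k. S k x) * of_bool (S n x = u)) * h u)"
proof -
  have int: "integrable M (\<lambda>x. g (\<lambda>k. S k x) * of_bool (S n x = u))" for u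
    by (intro integrable_history[where g = "\<lambda>s. g s * of_bool (s n = u)" and n = n]
        history_dependent_mult g history_dependent_coordinate[where h = "\<lambda>v. of_bool (v = u)"]) auto
  have "expectation (\<lambda>x. g (\<lambda>k. S k x) * h (S n x)) =
      expectation (\<lambda>x. \<Sum>u<dim_row P. g (\<lambda>k. S k x) * of_bool (S n x = u) * h u)"
  proof (intro Bochner_Integration.integral_cong refl)
    fix x assume x: "x \<in> space M"
    show "g (\<lambda>k. S k x) * h (S n x) = (\<Sum>u<dim_row P. g (\<lambda>k. S k x) * of_bool (S n x = u) * h u)"
      using state_less[OF x, of n] by (subst sum.remove[of _ "S n x"]) auto
  qed
  also have "\<dots> = (\<Sum>u<dim_row P. expectation (\<lambda>x. g (\<lambda>k. S k x) * of_bool (S n x = u)) * h u)"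
    using int by (subst Bochner_Integration.integral_sum) auto
  finally show ?thesis .
qed

text \<open>One step of the chain as a vector-matrix product: with h = 1 the matrix is P, and with h
  u the reward of moving from u to j it is H.\<close>

lemma expectation_step_state:
  assumes g: "history_dependent n g" and j: "j < dim_row P"
  shows "expectation (\<lambda>x. g (\<lambda>k. S k x) * h (S n x) * of_bool (S (Suc n) x = j)) =
    (\<Sum>u<dim_row P. expectation (\<lambda>x. g (\<lambda>k. S k x) * of_bool (S n x = u)) * (h u * P $$ (u, j)))"
proof -
  have "history_dependent n (\<lambda>s. g s * h (s n))"
    by (intro history_dependent_mult g history_dependent_coordinate) simp
  from expectation_step[OF this j]
  show ?thesis
    by (simp add: expectation_split_state[OF g, of "\<lambda>u. h u * P $$ (u, j)", symmetric] mult.assoc)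
qed

section \<open>Recursions for joint probabilities and joint rewards\<close>

lemma carrier_transition: "P \<in> carrier_mat (dim_row P) (dim_row P)"
  using stochastic by (auto simp: stochastic_matrix_def)

text \<open>\<open>joint_prob\<close> and \<open>joint_reward\<close> are the W_n and V_n of the
  opening comment. They are not divided by Pr(S_0 = i), so their recursions are linear and hold for
  initial states of probability 0 too.\<close>

definition joint_prob :: "nat \<Rightarrow> nat \<Rightarrow> nat \<Rightarrow> real" where
  "joint_prob n i j = expectation (\<lambda>x. of_bool (S 0 x = i) * of_bool (S n x = j))"

definition joint_reward :: "real mat \<Rightarrow> nat \<Rightarrow> nat \<Rightarrow> nat \<Rightarrow> real" where
  "joint_reward \<Theta> n i j =
    expectation (\<lambda>x. acc_reward \<Theta> S n x * of_bool (S 0 x = i) * of_bool (S n x = j))"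

lemma joint_prob_Suc:
  assumes j: "j < dim_row P"
  shows "joint_prob (Suc n) i j = (\<Sum>u<dim_row P. joint_prob n i u * P $$ (u, j))"
  using expectation_step_state[where g = "\<lambda>s. of_bool (s 0 = i)" and h = "\<lambda>_. 1", OF _ j,
      OF history_dependent_coordinate[where h = "\<lambda>u. of_bool (u = i)"], of n]
  by (simp add: joint_prob_def)

lemma joint_prob_eq:
  assumes i: "i < dim_row P" and j: "j < dim_row P"
  shows "joint_prob n i j = prob {x \<in> space M. S 0 x = i} * (P ^\<^sub>m n) $$ (i, j)"
  using j
proof (induction n arbitrary: j)
  case 0
  have "joint_prob 0 i j = expectation (\<lambda>x. of_bool (i = j) * indicator {x \<in> space M. S 0 x = i} x)"
    unfolding joint_prob_def by (intro Bochner_Integration.integral_cong) (auto simp: indicator_def)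
  also have "\<dots> = of_bool (i = j) * prob {x \<in> space M. S 0 x = i}"
    by (subst integral_mult_right_zero) simp
  finally show ?case using i 0 by simp
next
  case (Suc n)
  have "(P ^\<^sub>m Suc n) $$ (i, j) = (\<Sum>u<dim_row P. (P ^\<^sub>m n) $$ (i, u) * P $$ (u, j))"
    unfolding pow_mat.simps
    by (rule index_mult_mat_sum[OF pow_carrier_mat[OF carrier_transition] carrier_transition i Suc.prems])
  moreover have "joint_prob (Suc n) i j =
      (\<Sum>u<dim_row P. prob {x \<in> space M. S 0 x = i} * (P ^\<^sub>m n) $$ (i, u) * P $$ (u, j))"
    unfolding joint_prob_Suc[OF Suc.prems] by (intro sum.cong refl) (simp add: Suc.IH)
  ultimately show ?case by (simp only: sum_distrib_left mult.assoc)
qed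

text \<open>The first sum carries the earlier rewards through one more step, V_n P; the second is
  the reward of step n + 1 itself, W_n H.\<close>

lemma joint_reward_Suc:
  assumes j: "j < dim_row P"
  shows "joint_reward \<Theta> (Suc n) i j = (\<Sum>u<dim_row P. joint_reward \<Theta> n i u * P $$ (u, j)) +
    (\<Sum>u<dim_row P. joint_prob n i u * (\<Theta> $$ (u, j) * P $$ (u, j)))"
proof -
  let ?g = "\<lambda>s. acc_reward \<Theta> (\<lambda>k s. s k) n s * of_bool (s 0 = i)"
  let ?d = "\<lambda>s :: nat \<Rightarrow> nat. of_bool (s 0 = i) :: real"
  have d: "history_dependent m ?d" for m
    by (rule history_dependent_coordinate[where h = "\<lambda>u. of_bool (u = i)"]) simp
  have g: "history_dependent n ?g"
    by (intro history_dependent_mult history_dependent_acc_reward d)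
  have e: "history_dependent (Suc n) (\<lambda>s :: nat \<Rightarrow> nat. of_bool (s (Suc n) = j) :: real)"
    by (rule history_dependent_coordinate[where h = "\<lambda>u. of_bool (u = j)"]) simp
  have h: "history_dependent (Suc n) (\<lambda>s :: nat \<Rightarrow> nat. \<Theta> $$ (s n, j))"
    by (rule history_dependent_coordinate[where h = "\<lambda>u. \<Theta> $$ (u, j)"]) simp
  \<comment> \<open>On the event S_(n+1) = j the last reward is
    \<open>\<Theta> $$ (S n x, j)\<close>, a function of the past, so
    \<open>expectation_step_state\<close> applies to both terms.\<close>
  have "joint_reward \<Theta> (Suc n) i j =
      expectation (\<lambda>x. ?g (\<lambda>k. S k x) * of_bool (S (Suc n) x = j) +
        ?d (\<lambda>k. S k x) * \<Theta> $$ (S n x, j) * of_bool (S (Suc n) x = j))"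
    unfolding joint_reward_def acc_reward_Suc
    by (intro Bochner_Integration.integral_cong) (auto simp: acc_reward_path)
  also have "\<dots> = expectation (\<lambda>x. ?g (\<lambda>k. S k x) * of_bool (S (Suc n) x = j)) +
      expectation (\<lambda>x. ?d (\<lambda>k. S k x) * \<Theta> $$ (S n x, j) * of_bool (S (Suc n) x = j))"
    using integrable_history[OF history_dependent_mult[OF history_dependent_mono[OF g] e]]
      integrable_history[OF history_dependent_mult[OF history_dependent_mult[OF d h] e]]
    by (intro Bochner_Integration.integral_add) auto
  also have "\<dots> = (\<Sum>u<dim_row P. joint_reward \<Theta> n i u * P $$ (u, j)) +
    (\<Sum>u<dim_row P. joint_prob n i u * (\<Theta> $$ (u, j) * P $$ (u, j)))"
    using expectation_step_state[where h = "\<lambda>_. 1", OF g j]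
      expectation_step_state[where h = "\<lambda>u. \<Theta> $$ (u, j)", OF d j]
    by (simp add: joint_reward_def joint_prob_def acc_reward_path)
  finally show ?thesis .
qed

text \<open>By induction: the factor P on the right raises the last exponent of every old term by
  one, and W_n H supplies the new term k = n.\<close>

lemma joint_reward_eq:
  assumes \<Theta>: "\<Theta> \<in> carrier_mat (dim_row P) (dim_row P)"
    and i: "i < dim_row P" and j: "j < dim_row P"
  shows "joint_reward \<Theta> n i j = prob {x \<in> space M. S 0 x = i} *
    (\<Sum>k<n. (P ^\<^sub>m k * hadamard \<Theta> P * P ^\<^sub>m (n - k - 1)) $$ (i, j))"
  using j
proof (induction n arbitrary: j)
  case 0
  then show ?case by (simp add: joint_reward_def acc_reward_def)
next
  case (Suc n)
  let ?p = "prob {x \<in> space M. S 0 x = i}"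
  let ?X = "\<lambda>k l. P ^\<^sub>m k * hadamard \<Theta> P * P ^\<^sub>m l"
  have H: "hadamard \<Theta> P \<in> carrier_mat (dim_row P) (dim_row P)"
    using \<Theta> by (auto simp: hadamard_def)
  note pow = pow_carrier_mat[OF carrier_transition]
  have X: "?X k l \<in> carrier_mat (dim_row P) (dim_row P)" for k l
    by (intro mult_carrier_mat[of _ _ "dim_row P"] pow H)
  \<comment> \<open>The new term k = n, in which no step follows the rewarded one.\<close>
  have last: "?X n 0 $$ (i, j) = (\<Sum>u<dim_row P. (P ^\<^sub>m n) $$ (i, u) * (\<Theta> $$ (u, j) * P $$ (u, j)))"
  proof -
    have "?X n 0 = P ^\<^sub>m n * hadamard \<Theta> P"
      using right_mult_one_mat[OF mult_carrier_mat[OF pow H]] by simp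
    then have "?X n 0 $$ (i, j) = (\<Sum>u<dim_row P. (P ^\<^sub>m n) $$ (i, u) * hadamard \<Theta> P $$ (u, j))"
      by (simp only: index_mult_mat_sum[OF pow H i Suc.prems])
    also have "\<dots> = (\<Sum>u<dim_row P. (P ^\<^sub>m n) $$ (i, u) * (\<Theta> $$ (u, j) * P $$ (u, j)))"
      using \<Theta> Suc.prems by (intro sum.cong refl) (auto simp: hadamard_def)
    finally show ?thesis .
  qed
  \<comment> \<open>For \<open>k < n\<close> the subtraction \<open>n - k - 1\<close> on naturals is
    exact, so its successor is n - k.\<close>
  have step: "?X k (n - k) $$ (i, j) = (\<Sum>u<dim_row P. ?X k (n - k - 1) $$ (i, u) * P $$ (u, j))"
    if "k < n" for k
  proof -
    from that obtain l where l: "n - k = Suc l" by (metis Suc_diff_Suc)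
    have "?X k (n - k) = ?X k l * P"
      by (simp only: l pow_mat.simps assoc_mult_mat[OF mult_carrier_mat[OF pow H] pow carrier_transition])
    then show ?thesis
      using l by (simp only: index_mult_mat_sum[OF X carrier_transition i Suc.prems] diff_Suc_1)
  qed
  have "joint_reward \<Theta> (Suc n) i j =
      ?p * ((\<Sum>u<dim_row P. (\<Sum>k<n. ?X k (n - k - 1) $$ (i, u)) * P $$ (u, j)) + ?X n 0 $$ (i, j))"
  proof -
    have "(\<Sum>u<dim_row P. joint_reward \<Theta> n i u * P $$ (u, j)) =
        (\<Sum>u<dim_row P. ?p * ((\<Sum>k<n. ?X k (n - k - 1) $$ (i, u)) * P $$ (u, j)))"
      by (intro sum.cong refl) (simp only: Suc.IH lessThan_iff mult.assoc)
    moreover have "(\<Sum>u<dim_row P. joint_prob n i u * (\<Theta> $$ (u, j) * P $$ (u, j))) =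
        (\<Sum>u<dim_row P. ?p * ((P ^\<^sub>m n) $$ (i, u) * (\<Theta> $$ (u, j) * P $$ (u, j))))"
      by (intro sum.cong refl) (simp only: joint_prob_eq[OF i] lessThan_iff mult.assoc)
    ultimately show ?thesis
      by (simp only: joint_reward_Suc[OF Suc.prems] last distrib_left sum_distrib_left)
  qed
  also have "(\<Sum>u<dim_row P. (\<Sum>k<n. ?X k (n - k - 1) $$ (i, u)) * P $$ (u, j)) =
      (\<Sum>k<n. ?X k (n - k) $$ (i, j))"
    unfolding sum_distrib_right by (subst sum.swap) (intro sum.cong refl step[symmetric], simp)
  finally show ?case by simp
qed

section \<open>From joint quantities to conditional expectations\<close>

text \<open>The probability of S_0 = i and S_n = j cancels between the conditional expectation and
  its weight.\<close>

lemma weighted_reward_eq: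
  assumes pos: "prob {x \<in> space M. S 0 x = i} > 0"
  shows "weighted_reward M S \<Theta> n i j = joint_reward \<Theta> n i j / prob {x \<in> space M. S 0 x = i}"
proof -
  let ?E = "{x \<in> space M. S 0 x = i \<and> S n x = j}"
  have E: "?E \<in> events"
  proof -
    have "?E = {x \<in> space M. S 0 x = i} \<inter> {x \<in> space M. S n x = j}" by auto
    then show ?thesis by (simp only: sets.Int[OF state_event state_event])
  qed
  have V: "(LINT x:?E|M. acc_reward \<Theta> S n x) = joint_reward \<Theta> n i j"
    unfolding joint_reward_def set_lebesgue_integral_def
    by (intro Bochner_Integration.integral_cong refl) (simp add: indicator_def)
  have W: "cond_prob M (\<lambda>x. S n x = j) (\<lambda>x. S 0 x = i) = prob ?E / prob {x \<in> space M. S 0 x = i}"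
    by (simp add: cond_prob_def conj_commute)
  show ?thesis
  proof (cases "prob ?E = 0")
    \<comment> \<open>The integral over a null event is 0, which agrees with the default value in
      \<open>weighted_reward\<close>.\<close>
    case True
    then have "?E \<in> null_sets M" using E by (auto simp: emeasure_eq_measure)
    then have "AE x in M. x \<notin> ?E" by (rule AE_not_in)
    then have "joint_reward \<Theta> n i j = 0"
      unfolding V[symmetric] set_lebesgue_integral_def
      by (intro integral_eq_zero_AE) (elim eventually_mono, simp add: indicator_def)
    with True W show ?thesis by (simp add: weighted_reward_def)
  next
    case False
    with pos V W show ?thesis
      by (simp add: weighted_reward_def mean_reward_to_def cond_expect_def)
  qed
qed

text \<open>The events S_n = j partition the space, so the integral over S_0 = i is the sum of the
  joint rewards over j.\<close>

lemma mean_reward_eq: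
  "mean_reward M S \<Theta> n i =
    (\<Sum>j<dim_row P. joint_reward \<Theta> n i j) / prob {x \<in> space M. S 0 x = i}"
proof -
  let ?g = "\<lambda>s. acc_reward \<Theta> (\<lambda>k s. s k) n s * of_bool (s 0 = i)"
  have g: "history_dependent n ?g"
    by (intro history_dependent_mult history_dependent_acc_reward
        history_dependent_coordinate[where h = "\<lambda>u. of_bool (u = i)"]) simp
  have "(LINT x:{x \<in> space M. S 0 x = i}|M. acc_reward \<Theta> S n x) = expectation (\<lambda>x. ?g (\<lambda>k. S k x) * 1)"
    unfolding set_lebesgue_integral_def
    by (intro Bochner_Integration.integral_cong) (auto simp: indicator_def acc_reward_path)
  also have "\<dots> = (\<Sum>j<dim_row P. joint_reward \<Theta> n i j)"
    using expectation_split_state[OF g, of "\<lambda>_. 1"] by (simp add: joint_reward_def acc_reward_path)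
  finally show ?thesis by (simp add: mean_reward_def cond_expect_def)
qed

end

section \<open>Assembly of the blocks\<close>

text \<open>The range \<open>{..<n - 1}\<close> in \<open>B\<close> is 0 to n - 2 and is empty for n
  = 1, in accordance with the convention on empty sums. The claim for \<open>i\<close> supposes
  Pr(S_0 = i) > 0, as the conditional quantities otherwise carry only default values.\<close>

theorem theorem2:
  fixes M :: "'w measure" and S :: "nat \<Rightarrow> 'w \<Rightarrow> nat"
    and P Q R \<Theta> \<Theta>1 \<Theta>2 H H1 H2 N A B :: "real mat"
    and t a n :: nat
  assumes chain: "finite_markov_chain M S P"
    and absorbing: "absorbing_chain P"
    and Q: "Q \<in> carrier_mat t t" and R: "R \<in> carrier_mat t a"
    and P: "P = four_block_mat Q R (0\<^sub>m a t) (1\<^sub>m a)"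
    and transient_first: "\<And>i. i < t \<Longrightarrow> transient_state P i"
    and \<Theta>1: "\<Theta>1 \<in> carrier_mat t t" and \<Theta>2: "\<Theta>2 \<in> carrier_mat t a"
    and \<Theta>: "\<Theta> = four_block_mat \<Theta>1 \<Theta>2 (0\<^sub>m a t) (0\<^sub>m a a)"
    and H: "H = hadamard \<Theta> P"
    and H1: "H1 \<in> carrier_mat t t" and H2: "H2 \<in> carrier_mat t a"
    and H_blocks: "H = four_block_mat H1 H2 (0\<^sub>m a t) (0\<^sub>m a a)"
    and N: "N = fundamental_matrix Q"
    and n: "n \<ge> 1"
    and A: "A = msum t t (\<lambda>k. (Q ^\<^sub>m k) * H1 * (Q ^\<^sub>m (n - k - 1))) {..<n}"
    and B: "B = N * (1\<^sub>m t - Q ^\<^sub>m n) * H2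
              + N * (1\<^sub>m t - Q ^\<^sub>m (n - 1)) * H1 * N * R
              - msum t a (\<lambda>k. (Q ^\<^sub>m k) * H1 * N * (Q ^\<^sub>m (n - k - 1)) * R) {..<n - 1}"
  shows "\<forall>i < t + a. measure M {x \<in> space M. S 0 x = i} > 0 \<longrightarrow>
           mean_reward M S \<Theta> n i = (\<Sum>j < t + a. weighted_reward M S \<Theta> n i j)
           \<and> (\<forall>j < t + a. weighted_reward M S \<Theta> n i j
                 = four_block_mat A B (0\<^sub>m a t) (0\<^sub>m a a) $$ (i, j))"
proof -
  interpret finite_markov_chain M S P by (rule chain)
  have dim: "dim_row P = t + a" using P Q by simp
  note N_inv = fundamental_matrix_inverse[OF stochastic absorbing Q R P transient_first, folded N]
  have \<Theta>_carrier: "\<Theta> \<in> carrier_mat (dim_row P) (dim_row P)"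
    unfolding \<Theta> dim using \<Theta>1 by (intro four_block_carrier_mat) auto
  have carriers: "Q ^\<^sub>m k * H1 * Q ^\<^sub>m l \<in> carrier_mat t t"
    "Q ^\<^sub>m k * H1 * (msum t t (\<lambda>k. Q ^\<^sub>m k) {..<l} * R) + Q ^\<^sub>m k * H2 \<in> carrier_mat t a" for k l
    by (intro add_carrier_mat mult_carrier_mat[of _ t t] pow_carrier_mat Q H1 H2 R msum_carrier)+
  \<comment> \<open>The closed form is turned back into a sum over k, so that it can be matched with
    the upper right blocks of the terms P^k H P^(n-k-1).\<close>
  have B': "B = msum t a (\<lambda>k. Q ^\<^sub>m k * H1 * (msum t t (\<lambda>k. Q ^\<^sub>m k) {..<n - k - 1} * R) + Q ^\<^sub>m k * H2) {..<n}"
    unfolding B by (rule msum_reward_block[OF Q N_inv R H1 H2 n, symmetric])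
  have blocks: "msum (t + a) (t + a) (\<lambda>k. P ^\<^sub>m k * H * P ^\<^sub>m (n - k - 1)) {..<n} =
      four_block_mat A B (0\<^sub>m a t) (0\<^sub>m a a)"
    unfolding A B' H_blocks P block_step_rewards[OF Q R H1 H2]
    by (subst msum_four_block[OF carriers zero_carrier_mat zero_carrier_mat]) simp
  show ?thesis
  proof (intro allI impI)
    fix i assume i: "i < t + a" and pos: "prob {x \<in> space M. S 0 x = i} > 0"
    have "weighted_reward M S \<Theta> n i j = four_block_mat A B (0\<^sub>m a t) (0\<^sub>m a a) $$ (i, j)"
      if "j < t + a" for j
      using pos i that unfolding weighted_reward_eq[OF pos] blocks[symmetric] H
      by (simp add: joint_reward_eq[OF \<Theta>_carrier] dim)
    moreover have "mean_reward M S \<Theta> n i = (\<Sum>j<t + a. weighted_reward M S \<Theta> n i j)"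
      by (simp add: mean_reward_eq weighted_reward_eq[OF pos] sum_divide_distrib dim)
    ultimately show "mean_reward M S \<Theta> n i = (\<Sum>j<t + a. weighted_reward M S \<Theta> n i j) \<and>
        (\<forall>j<t + a. weighted_reward M S \<Theta> n i j = four_block_mat A B (0\<^sub>m a t) (0\<^sub>m a a) $$ (i, j))"
      by blast
  qed
qed

end
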